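(* There is an absolute constant $C>0$ such that the following holds. Let $k, N \in \mathbf{N}$ and let $v_1, \ldots, v_m$ be a finite sequence of vectors in $\mathbf{C}^k$ satisfying $\|v_i\| = \frac{1}{\sqrt{N}}$ for $1 \leq i \leq m$ and \[\sum_{i=1}^m |\langle u,v_i\rangle|^2 = 1\] for all unit vectors $u \in \mathbf{C}^k$. Then for any integer $n$ with $0 \le n < m$ there is a set $S \subseteq \{1, \ldots, m\}$ with $|S| = n$ such that \[\sum_{i \in S} |\langle u,v_i\rangle|^2 \leq \frac{n}{m} + \frac{C}{\sqrt{N}}\] for all unit vectors $u \in \mathbf{C}^k$.
   Context: $\|\cdot\|$ denotes the Euclidean norm on $\mathbf{C}^k$ and $\langle\cdot,\cdot\rangle$ the standard inner product. The paper states the bound as $\frac{n}{m} + O\left(\frac{1}{\sqrt{N}}\right)$; the implied constant is independent of $k$, $N$, $m$, $n$ and the vectors, which is what $C$ expresses. *)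

theory Defs
  imports "Jordan_Normal_Form.Matrix" "HOL-Analysis.L2_Norm"
begin

(* C^k is carrier_vec k :: complex vec set, since k is quantified inside the scope of the
   absolute constant; the standard inner product <u, v> is u \<bullet>c v, linear in u. *)

definition euclidean_norm :: "complex vec \<Rightarrow> real" where
  "euclidean_norm v = L2_set (\<lambda>j. cmod (v $ j)) {..<dim_vec v}"

end

theory Submission
  imports Defs "Jordan_Normal_Form.Char_Poly" "HOL-Analysis.Function_Topology"
begin

text \<open>
  Let A be the Gram matrix of the vectors: the bound for S is a bound on the largest eigenvalue of the
  principal submatrix of A indexed by S. Indices are deleted from A one at a time, keeping the barrier
  \<open>tr (b - A)\<^sup>-\<^sup>1 = \<chi>'(b) / \<chi>(b)\<close> at most m while b decreases by 1/m in each step. This is possible because the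
  characteristic polynomials \<open>\<chi>\<^sub>i\<close> of the submatrices with one index deleted satisfy \<open>\<Sum> \<chi>\<^sub>i = \<chi>'\<close>, hence
  \<open>\<Sum> (\<chi>\<^sub>i' - m \<chi>\<^sub>i) = \<chi>'' - m \<chi>'\<close>, and the right-hand side is nonpositive at b - 1/m by the
  Cauchy-Schwarz inequality. Since \<open>0 \<le> A \<le> 1\<close> and A has trace m/N, the barrier is at most m at the
  starting point \<open>b = 1 + 1/\<surd>N\<close>; after m - n steps b has become \<open>n/m + 1/\<surd>N\<close>. So C = 1 works.
\<close>

section \<open>Cauchy-Schwarz and the norm of an adjoint matrix\<close>

lemma Cauchy_Schwarz_sum_squares:
  fixes f g :: "'a \<Rightarrow> real"
  shows "(\<Sum>i\<in>I. f i * g i)\<^sup>2 \<le> (\<Sum>i\<in>I. (f i)\<^sup>2) * (\<Sum>i\<in>I. (g i)\<^sup>2)"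
proof -
  have "\<bar>\<Sum>i\<in>I. f i * g i\<bar> \<le> (\<Sum>i\<in>I. \<bar>f i\<bar> * \<bar>g i\<bar>)"
    by (rule order_trans[OF sum_abs]) (simp add: abs_mult)
  also have "\<dots> \<le> L2_set f I * L2_set g I"
    by (rule L2_set_mult_ineq)
  finally have "\<bar>\<Sum>i\<in>I. f i * g i\<bar>\<^sup>2 \<le> (L2_set f I * L2_set g I)\<^sup>2"
    by (intro power_mono) auto
  then show ?thesis
    by (simp add: power_mult_distrib L2_set_def sum_nonneg)
qed

text \<open>For \<open>x = M^* y\<close>, the quantity \<open>X = |x|^2\<close> is the pairing of
  \<open>y\<close> with \<open>M x\<close>, hence \<open>X^2 \<le> |y|^2 * c * X\<close> by
  Cauchy-Schwarz, and one factor \<open>X\<close> cancels. This passes between linear combinations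
  of the vectors and their inner products with a test vector.\<close>

lemma adjoint_norm_bound:
  fixes M :: "nat \<Rightarrow> nat \<Rightarrow> complex"
  assumes bound: "\<And>x. (\<Sum>i<p. (cmod (\<Sum>j<q. M i j * x j))\<^sup>2) \<le> c * (\<Sum>j<q. (cmod (x j))\<^sup>2)"
    and "c \<ge> 0"
  shows "(\<Sum>j<q. (cmod (\<Sum>i<p. cnj (M i j) * y i))\<^sup>2) \<le> c * (\<Sum>i<p. (cmod (y i))\<^sup>2)"
proof -
  define x where "x j = (\<Sum>i<p. cnj (M i j) * y i)" for j
  define z where "z i = (\<Sum>j<q. M i j * x j)" for i
  define X where "X = (\<Sum>j<q. (cmod (x j))\<^sup>2)"
  have "complex_of_real X = (\<Sum>j<q. x j * cnj (x j))"
    by (simp add: X_def complex_norm_square del: of_real_power)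
  also have "\<dots> = (\<Sum>j<q. \<Sum>i<p. cnj (y i) * (M i j * x j))"
  proof (rule sum.cong[OF refl])
    fix j
    have "x j * cnj (x j) = x j * (\<Sum>i<p. M i j * cnj (y i))"
      by (subst (2) x_def) simp
    then show "x j * cnj (x j) = (\<Sum>i<p. cnj (y i) * (M i j * x j))"
      by (simp add: sum_distrib_left mult_ac)
  qed
  also have "\<dots> = (\<Sum>i<p. cnj (y i) * z i)"
    by (subst sum.swap) (simp add: z_def sum_distrib_left)
  finally have "cmod (complex_of_real X) = cmod (\<Sum>i<p. cnj (y i) * z i)"
    by simp
  also have "\<dots> \<le> (\<Sum>i<p. cmod (y i) * cmod (z i))"
    by (rule order_trans[OF norm_sum]) (simp add: norm_mult)
  finally have "X \<le> (\<Sum>i<p. cmod (y i) * cmod (z i))"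
    by simp
  moreover have X0: "X \<ge> 0"
    by (simp add: X_def sum_nonneg)
  ultimately have "X\<^sup>2 \<le> (\<Sum>i<p. cmod (y i) * cmod (z i))\<^sup>2"
    by (intro power_mono)
  also have "\<dots> \<le> (\<Sum>i<p. (cmod (y i))\<^sup>2) * (\<Sum>i<p. (cmod (z i))\<^sup>2)"
    by (rule Cauchy_Schwarz_sum_squares)
  also have "\<dots> \<le> (\<Sum>i<p. (cmod (y i))\<^sup>2) * (c * X)"
    using bound[of x] by (intro mult_left_mono) (auto simp: z_def X_def sum_nonneg)
  finally have "X * X \<le> (c * (\<Sum>i<p. (cmod (y i))\<^sup>2)) * X"
    by (simp add: power2_eq_square mult_ac)
  then have "X \<le> c * (\<Sum>i<p. (cmod (y i))\<^sup>2)"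
    using X0 \<open>c \<ge> 0\<close> by (cases "X = 0") (auto simp: sum_nonneg)
  then show ?thesis
    by (simp add: X_def x_def)
qed

section \<open>Hermitian matrices and the Rayleigh quotient\<close>

definition hermitian_mat :: "complex mat \<Rightarrow> bool" where
  "hermitian_mat A \<longleftrightarrow> (\<forall>i<dim_row A. \<forall>j<dim_row A. A $$ (j, i) = cnj (A $$ (i, j)))"

lemma hermitian_matI:
  assumes "A \<in> carrier_mat n n" and "\<And>i j. i < n \<Longrightarrow> j < n \<Longrightarrow> A $$ (j, i) = cnj (A $$ (i, j))"
  shows "hermitian_mat A"
  unfolding hermitian_mat_def using assms by blast

lemma hermitian_matD:
  assumes "hermitian_mat A" "A \<in> carrier_mat n n" "i < n" "j < n"
  shows "A $$ (j, i) = cnj (A $$ (i, j))"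
  using assms unfolding hermitian_mat_def by blast

text \<open>Vectors are encoded as functions, of which only the first \<open>dim_row A\<close>
  values count, so that compactness of the unit sphere can be taken from the product
  topology.\<close>

definition sesq_form :: "complex mat \<Rightarrow> (nat \<Rightarrow> complex) \<Rightarrow> (nat \<Rightarrow> complex) \<Rightarrow> complex" where
  "sesq_form A f g = (\<Sum>i<dim_row A. \<Sum>j<dim_row A. cnj (f i) * A $$ (i, j) * g j)"

lemma cnj_sesq_form:
  assumes "hermitian_mat A"
  shows "cnj (sesq_form A f g) = sesq_form A g f"
proof -
  have "cnj (sesq_form A f g) = (\<Sum>i<dim_row A. \<Sum>j<dim_row A. f i * cnj (A $$ (i, j)) * cnj (g j))"
    by (simp add: sesq_form_def)
  also have "\<dots> = (\<Sum>i<dim_row A. \<Sum>j<dim_row A. cnj (g j) * A $$ (j, i) * f i)"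
  proof (intro sum.cong refl)
    fix i j
    assume "i \<in> {..<dim_row A}" "j \<in> {..<dim_row A}"
    then have "A $$ (j, i) = cnj (A $$ (i, j))"
      using assms unfolding hermitian_mat_def by blast
    then show "f i * cnj (A $$ (i, j)) * cnj (g j) = cnj (g j) * A $$ (j, i) * f i"
      by simp
  qed
  also have "\<dots> = sesq_form A g f"
    unfolding sesq_form_def by (rule sum.swap)
  finally show ?thesis .
qed

lemma sesq_form_add_scaled:
  fixes t :: real and f g :: "nat \<Rightarrow> complex"
  assumes "hermitian_mat A"
  shows "Re (sesq_form A (\<lambda>i. f i + t * g i) (\<lambda>i. f i + t * g i)) =
    Re (sesq_form A f f) + 2 * t * Re (sesq_form A g f) + t\<^sup>2 * Re (sesq_form A g g)"
proof -
  have "sesq_form A (\<lambda>i. f i + t * g i) (\<lambda>i. f i + t * g i) =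
    sesq_form A f f + t * sesq_form A f g + t * sesq_form A g f + t\<^sup>2 * sesq_form A g g"
    by (simp add: sesq_form_def algebra_simps sum.distrib sum_distrib_left power2_eq_square)
  moreover have "sesq_form A f g = cnj (sesq_form A g f)"
    by (simp add: cnj_sesq_form assms)
  ultimately show ?thesis
    by (simp add: power2_eq_square)
qed

lemma sum_cmod_add_scaled:
  fixes t :: real and f g :: "'a \<Rightarrow> complex"
  shows "(\<Sum>i\<in>I. (cmod (f i + t * g i))\<^sup>2) =
    (\<Sum>i\<in>I. (cmod (f i))\<^sup>2) + 2 * t * Re (\<Sum>i\<in>I. cnj (g i) * f i) + t\<^sup>2 * (\<Sum>i\<in>I. (cmod (g i))\<^sup>2)"
  unfolding Re_sum sum_distrib_left sum.distrib[symmetric]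
  by (intro sum.cong refl) (simp only: cmod_power2, simp add: power2_eq_square algebra_simps)

lemma eigenvectorD_sesq_form:
  assumes A: "A \<in> carrier_mat n n" and ev: "eigenvector A v e"
  shows "sesq_form A (\<lambda>i. v $ i) (\<lambda>i. v $ i) = e * (\<Sum>i<n. (cmod (v $ i))\<^sup>2)"
    and "(\<Sum>i<n. (cmod (v $ i))\<^sup>2) > 0"
proof -
  have v: "v \<in> carrier_vec n" "v \<noteq> 0\<^sub>v n" and Av: "A *\<^sub>v v = e \<cdot>\<^sub>v v"
    using ev A by (auto simp: eigenvector_def)
  have row: "(\<Sum>j<n. A $$ (i, j) * v $ j) = e * v $ i" if "i < n" for i
  proof -
    have "(A *\<^sub>v v) $ i = (\<Sum>j<n. A $$ (i, j) * v $ j)"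
      using that A v by (simp add: scalar_prod_def atLeast0LessThan)
    then show ?thesis
      using that v by (simp add: Av)
  qed
  have "sesq_form A (\<lambda>i. v $ i) (\<lambda>i. v $ i) = (\<Sum>i<n. cnj (v $ i) * (\<Sum>j<n. A $$ (i, j) * v $ j))"
    using A by (simp add: sesq_form_def sum_distrib_left mult_ac)
  also have "\<dots> = (\<Sum>i<n. e * complex_of_real ((cmod (v $ i))\<^sup>2))"
    by (intro sum.cong refl) (simp add: row complex_norm_square del: of_real_power)
  finally show "sesq_form A (\<lambda>i. v $ i) (\<lambda>i. v $ i) = e * (\<Sum>i<n. (cmod (v $ i))\<^sup>2)"
    by (simp add: sum_distrib_left)
  obtain i where "i < n" "v $ i \<noteq> 0"
    using v by (metis carrier_vecD eq_vecI index_zero_vec)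
  then show "(\<Sum>i<n. (cmod (v $ i))\<^sup>2) > 0"
    by (intro sum_pos2[of _ i]) auto
qed

lemma hermitian_eigenvalue_real:
  assumes A: "A \<in> carrier_mat n n" and "hermitian_mat A" and "eigenvalue A e"
  shows "e \<in> \<real>"
proof -
  obtain v where ev: "eigenvector A v e"
    using assms(3) by (auto simp: eigenvalue_def)
  define s where "s = (\<Sum>i<n. (cmod (v $ i))\<^sup>2)"
  have "sesq_form A (\<lambda>i. v $ i) (\<lambda>i. v $ i) = e * s" "s > 0"
    using eigenvectorD_sesq_form[OF A ev] by (simp_all add: s_def)
  then have "cnj e = e"
    using cnj_sesq_form[OF assms(2), of "\<lambda>i. v $ i" "\<lambda>i. v $ i"] by simp
  then show ?thesis
    by (simp add: complex_is_Real_iff complex_eq_iff)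
qed

text \<open>For small negative \<open>t\<close> the linear term dominates the quadratic one. This is
  the first-order condition at a maximum of the Rayleigh quotient.\<close>

lemma quadratic_nonneg_imp_linear_zero:
  fixes g c :: real
  assumes nonneg: "\<And>t. 0 \<le> 2 * t * g + t\<^sup>2 * c" and "g \<ge> 0"
  shows "g = 0"
proof (rule ccontr)
  assume "g \<noteq> 0"
  then have g: "g > 0"
    using \<open>g \<ge> 0\<close> by simp
  \<comment> \<open>Nonnegativity at \<open>t = - e\<close> gives \<open>2 * g \<le> e * c\<close>,
    while this choice of \<open>e\<close> forces \<open>e * c \<le> g\<close>.\<close>
  define e where "e = g / (\<bar>c\<bar> + 1)"
  have e: "e > 0"
    using g by (simp add: e_def)
  have "0 \<le> e * (e * c - 2 * g)"
    using nonneg[of "- e"] by (simp add: power2_eq_square algebra_simps)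
  then have "2 * g \<le> e * c"
    using e by (simp add: zero_le_mult_iff)
  also have "\<dots> \<le> e * (\<bar>c\<bar> + 1)"
    using e by (intro mult_left_mono) auto
  also have "\<dots> = g"
    by (simp add: e_def)
  finally show False
    using g by simp
qed

text \<open>By Tychonoff: the sphere is a closed subset of a product of compact squares in the
  plane, the coordinates from \<open>n\<close> on being pinned to 0.\<close>

lemma compact_complex_sphere:
  "compact {f :: nat \<Rightarrow> complex. (\<forall>i\<ge>n. f i = 0) \<and> (\<Sum>i<n. (cmod (f i))\<^sup>2) = 1}"
proof -
  define Q where "Q = (\<lambda>(a, b). Complex a b) ` ({-1..1} \<times> {-1..1})"
  have "compact Q"
    unfolding Q_def case_prod_beta
    by (intro compact_continuous_image compact_Times compact_Icc continuous_intros)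
  define B where "B = PiE UNIV (\<lambda>i. if i < n then Q else {0})"
  have "compactin (product_topology (\<lambda>i. euclidean) UNIV) B"
    unfolding B_def compactin_PiE using \<open>compact Q\<close> by auto
  then have "compact B"
    by (simp add: euclidean_product_topology)
  moreover have "closed {f :: nat \<Rightarrow> complex. (\<Sum>i<n. (cmod (f i))\<^sup>2) = 1}"
    by (intro closed_Collect_eq continuous_intros continuous_on_product_coordinates)
  ultimately have "compact (B \<inter> {f. (\<Sum>i<n. (cmod (f i))\<^sup>2) = 1})"
    by (rule compact_Int_closed)
  moreover have "B \<inter> {f. (\<Sum>i<n. (cmod (f i))\<^sup>2) = 1} =
    {f. (\<forall>i\<ge>n. f i = 0) \<and> (\<Sum>i<n. (cmod (f i))\<^sup>2) = 1}"
  proof -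
    have "f i \<in> Q" if "(\<Sum>i<n. (cmod (f i))\<^sup>2) = 1" "i < n" for f :: "nat \<Rightarrow> complex" and i
    proof -
      have "(cmod (f i))\<^sup>2 \<le> (\<Sum>i<n. (cmod (f i))\<^sup>2)"
        using that by (intro member_le_sum) auto
      then have "cmod (f i) \<le> 1"
        using that by (simp add: abs_square_le_1)
      then have "\<bar>Re (f i)\<bar> \<le> 1" "\<bar>Im (f i)\<bar> \<le> 1"
        using abs_Re_le_cmod abs_Im_le_cmod order_trans by blast+
      then show ?thesis
        unfolding Q_def by (intro image_eqI[of _ _ "(Re (f i), Im (f i))"]) auto
    qed
    then show ?thesis
      by (auto simp: B_def PiE_iff split: if_splits)
  qed
  ultimately show ?thesis
    by simp
qed

text \<open>The form attains its maximum \<open>\<mu>\<close> on the unit sphere at some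
  \<open>w\<close>; the first variation there vanishes, so \<open>w\<close> is an eigenvector for
  \<open>\<mu>\<close>.\<close>

lemma hermitian_Rayleigh:
  assumes A: "A \<in> carrier_mat n n" and herm: "hermitian_mat A" and "n > 0"
  obtains \<mu> :: real where "eigenvalue A \<mu>"
    and "\<And>f. Re (sesq_form A f f) \<le> \<mu> * (\<Sum>i<n. (cmod (f i))\<^sup>2)"
proof -
  define K where "K = {f :: nat \<Rightarrow> complex. (\<forall>i\<ge>n. f i = 0) \<and> (\<Sum>i<n. (cmod (f i))\<^sup>2) = 1}"
  have n: "dim_row A = n" using A by simp
  have "(\<Sum>i<n. (cmod (if i = 0 then 1 else 0))\<^sup>2) = (\<Sum>i<n. if i = 0 then 1 else 0 :: real)"
    by (intro sum.cong) auto
  then have "(\<lambda>i. if i = 0 then 1 else 0) \<in> K"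
    using \<open>n > 0\<close> by (auto simp: K_def)
  then have "K \<noteq> {}" by auto
  have cont: "continuous_on K (\<lambda>f. Re (sesq_form A f f))"
    unfolding sesq_form_def
    by (intro continuous_intros continuous_on_subset[OF continuous_on_product_coordinates]) auto
  obtain w where w: "w \<in> K" and max: "\<And>f. f \<in> K \<Longrightarrow> Re (sesq_form A f f) \<le> Re (sesq_form A w w)"
    using continuous_attains_sup[OF compact_complex_sphere[of n, folded K_def] \<open>K \<noteq> {}\<close> cont] by auto
  define \<mu> where "\<mu> = Re (sesq_form A w w)"
  have le: "Re (sesq_form A f f) \<le> \<mu> * (\<Sum>i<n. (cmod (f i))\<^sup>2)" for f
  proof (cases "(\<Sum>i<n. (cmod (f i))\<^sup>2) = 0")
    case True
    then have "\<forall>i<n. f i = 0"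
      by (subst (asm) sum_nonneg_eq_0_iff) auto
    then have "sesq_form A f f = 0"
      by (simp add: sesq_form_def n)
    then show ?thesis
      using True by simp
  next
    case False
    define s where "s = (\<Sum>i<n. (cmod (f i))\<^sup>2)"
    have s: "s > 0"
      using False unfolding s_def by (simp add: less_le sum_nonneg)
    \<comment> \<open>Normalizing and cutting off at \<open>n\<close> moves \<open>f\<close> into
      \<open>K\<close>; the form does not see the discarded coordinates.\<close>
    define g where "g i = (if i < n then f i / sqrt s else 0)" for i
    have "(\<Sum>i<n. (cmod (g i))\<^sup>2) = (\<Sum>i<n. (cmod (f i))\<^sup>2 / s)"
      using s by (intro sum.cong) (auto simp: g_def norm_divide power_divide)
    also have "\<dots> = 1"
      using s by (simp add: s_def sum_divide_distrib[symmetric])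
    finally have "g \<in> K"
      by (simp add: K_def g_def)
    moreover have "sesq_form A g g = sesq_form A f f / s"
    proof -
      have "cnj (g i) * A $$ (i, j) * g j = cnj (f i) * A $$ (i, j) * f j / s" if "i < n" "j < n" for i j
      proof -
        have "complex_of_real (sqrt s) * complex_of_real (sqrt s) = s"
          using s by (simp flip: of_real_mult)
        then show ?thesis
          using that by (simp add: g_def)
      qed
      then show ?thesis
        by (simp add: sesq_form_def n sum_divide_distrib)
    qed
    ultimately have "Re (sesq_form A f f) / s \<le> \<mu>"
      using max[of g] by (simp add: \<mu>_def)
    then show ?thesis
      using s by (simp add: s_def[symmetric] field_simps)
  qed
  \<comment> \<open>The residual of the eigenvalue equation for \<open>w\<close>. Varying
    \<open>w\<close> in this very direction makes the linear coefficient equal to \<open>G\<close>,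
    the squared norm of the residual.\<close>
  define g where "g i = \<mu> * w i - (\<Sum>j<n. A $$ (i, j) * w j)" for i
  define G where "G = (\<Sum>i<n. (cmod (g i))\<^sup>2)"
  define R where "R = Re (\<Sum>i<n. cnj (g i) * w i)"
  define X where "X = Re (sesq_form A g w)"
  have w1: "(\<Sum>i<n. (cmod (w i))\<^sup>2) = 1"
    using w by (simp add: K_def)
  have "complex_of_real G = (\<Sum>i<n. cnj (g i) * g i)"
    by (simp add: G_def complex_norm_square mult.commute del: of_real_power)
  also have "\<dots> = (\<Sum>i<n. cnj (g i) * (\<mu> * w i - (\<Sum>j<n. A $$ (i, j) * w j)))"
    by (simp add: g_def)
  also have "\<dots> = \<mu> * (\<Sum>i<n. cnj (g i) * w i) - sesq_form A g w"
    by (simp add: sesq_form_def n right_diff_distrib sum_subtractf sum_distrib_left mult_ac)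
  finally have "Re (complex_of_real G) = Re (\<mu> * (\<Sum>i<n. cnj (g i) * w i) - sesq_form A g w)"
    by (rule arg_cong)
  then have G: "G = \<mu> * R - X"
    by (simp add: R_def X_def del: Re_sum)
  have "0 \<le> 2 * t * G + t\<^sup>2 * (\<mu> * G - Re (sesq_form A g g))" for t
  proof -
    \<comment> \<open>Expand the bound \<open>le\<close> at \<open>w + t * g\<close>; the constant
      terms on both sides are \<open>\<mu>\<close> and cancel.\<close>
    have "\<mu> + 2 * t * X + t\<^sup>2 * Re (sesq_form A g g) \<le> \<mu> * (1 + 2 * t * R + t\<^sup>2 * G)"
      using le[of "\<lambda>i. w i + t * g i"]
      unfolding sesq_form_add_scaled[OF herm] sum_cmod_add_scaled w1 \<mu>_def[symmetric] G_def[symmetric]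
        R_def[symmetric] X_def[symmetric] .
    moreover have "2 * t * G = 2 * t * (\<mu> * R) - 2 * t * X"
      by (simp add: G right_diff_distrib)
    ultimately show ?thesis
      by (simp add: algebra_simps)
  qed
  moreover have "G \<ge> 0"
    by (simp add: G_def sum_nonneg)
  ultimately have "G = 0"
    by (rule quadratic_nonneg_imp_linear_zero)
  then have g0: "g i = 0" if "i < n" for i
    using that unfolding G_def by (subst (asm) sum_nonneg_eq_0_iff) auto
  have "vec n w \<noteq> 0\<^sub>v n"
  proof
    assume "vec n w = 0\<^sub>v n"
    then have "w i = 0" if "i < n" for i
      using that by (metis index_vec index_zero_vec(1))
    then show False
      using w1 by simp
  qed
  moreover have "A *\<^sub>v vec n w = complex_of_real \<mu> \<cdot>\<^sub>v vec n w"
    using A g0 by (intro eq_vecI) (auto simp: scalar_prod_def atLeast0LessThan g_def)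
  ultimately have "eigenvector A (vec n w) \<mu>"
    by (simp add: eigenvector_def n)
  then show thesis
    using that le by (auto simp: eigenvalue_def)
qed

section \<open>Principal submatrices and characteristic polynomials\<close>

lemma sum_insert_index:
  fixes F :: "nat \<Rightarrow> 'a :: ab_group_add"
  assumes "i < Suc n"
  shows "(\<Sum>j<n. F (insert_index i j)) = (\<Sum>j<Suc n. F j) - F i"
proof -
  have "(\<Sum>j<n. F (insert_index i j)) = sum F (insert_index i ` {..<n})"
    by (rule sum.reindex_cong[symmetric, OF insert_index_inj_on]) auto
  also have "insert_index i ` {..<n} = {..<Suc n} - {i}"
    using insert_index_image[OF assms] by (simp add: atLeast0LessThan)
  also have "sum F ({..<Suc n} - {i}) = (\<Sum>j<Suc n. F j) - F i"
    using assms by (subst sum_diff1) auto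
  finally show ?thesis .
qed

lemma mat_delete_diag_index:
  assumes "A \<in> carrier_mat (Suc n) (Suc n)" "i < Suc n" "a < n" "b < n"
  shows "mat_delete A i i $$ (a, b) = A $$ (insert_index i a, insert_index i b)"
  using mat_delete_index[OF assms(1,2,2,3,4)] by simp

lemma mat_delete_diag_carrier:
  assumes "A \<in> carrier_mat (Suc n) (Suc n)"
  shows "mat_delete A i i \<in> carrier_mat n n"
  using assms mat_delete_carrier[of A "Suc n" "Suc n" i i] by simp

lemma hermitian_mat_delete:
  assumes A: "A \<in> carrier_mat (Suc n) (Suc n)" and "hermitian_mat A" and i: "i < Suc n"
  shows "hermitian_mat (mat_delete A i i)"
proof (rule hermitian_matI[OF mat_delete_diag_carrier[OF A]])
  fix a b
  assume ab: "a < n" "b < n"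
  then have "insert_index i a < Suc n" "insert_index i b < Suc n"
    by (auto simp: insert_index_def)
  note hermitian_matD[OF assms(2) A this]
  then show "mat_delete A i i $$ (b, a) = cnj (mat_delete A i i $$ (a, b))"
    using ab by (simp add: mat_delete_diag_index[OF A i])
qed

lemma sesq_form_mat_delete:
  assumes A: "A \<in> carrier_mat (Suc n) (Suc n)" and i: "i < Suc n"
    and F: "F i = 0" "\<And>j. j < n \<Longrightarrow> F (insert_index i j) = f j"
  shows "sesq_form (mat_delete A i i) f f = sesq_form A F F"
proof -
  have "sesq_form A F F = (\<Sum>a<Suc n. \<Sum>b<Suc n. cnj (F a) * A $$ (a, b) * F b)"
    using A by (simp add: sesq_form_def)
  also have "\<dots> = (\<Sum>a<n. \<Sum>b<n. cnj (F (insert_index i a)) * A $$ (insert_index i a, insert_index i b) * F (insert_index i b))"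
    by (simp add: sum_insert_index[OF i, of "\<lambda>b. cnj (F a) * A $$ (a, b) * F b" for a] F(1)
        sum_insert_index[OF i, of "\<lambda>a. \<Sum>b<Suc n. cnj (F a) * A $$ (a, b) * F b"] del: sum.lessThan_Suc)
  also have "\<dots> = sesq_form (mat_delete A i i) f f"
    using A by (simp add: sesq_form_def mat_delete_diag_index[OF A i] F)
  finally show ?thesis by simp
qed

text \<open>An eigenvector of the submatrix, extended by 0 at index \<open>i\<close>, has the same
  norm and the same form value under \<open>A\<close>; the Rayleigh bound for \<open>A\<close>
  applies to it.\<close>

lemma hermitian_Cauchy_interlacing_max:
  assumes A: "A \<in> carrier_mat (Suc n) (Suc n)" and herm: "hermitian_mat A" and i: "i < Suc n"
    and ev: "eigenvalue (mat_delete A i i) (complex_of_real l)"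
  obtains \<mu> :: real where "eigenvalue A \<mu>" and "l \<le> \<mu>"
proof -
  obtain \<mu> :: real where \<mu>: "eigenvalue A \<mu>"
    and le: "\<And>f. Re (sesq_form A f f) \<le> \<mu> * (\<Sum>i<Suc n. (cmod (f i))\<^sup>2)"
    using hermitian_Rayleigh[OF A herm] by auto
  obtain v where v: "eigenvector (mat_delete A i i) v l"
    using ev by (auto simp: eigenvalue_def)
  note ev = eigenvectorD_sesq_form[OF mat_delete_diag_carrier[OF A] v]
  \<comment> \<open>The zero extension of \<open>v\<close>: \<open>delete_index i\<close> undoes the
    renumbering caused by deleting index \<open>i\<close>.\<close>
  define F where "F a = (if a = i then 0 else v $ delete_index i a)" for a
  have F: "F i = 0" "F (insert_index i j) = v $ j" for j
    by (simp_all add: F_def)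
  have "l * (\<Sum>a<n. (cmod (v $ a))\<^sup>2) = Re (sesq_form A F F)"
    using ev(1) sesq_form_mat_delete[OF A i, of F "\<lambda>a. v $ a"] F by simp
  also have "\<dots> \<le> \<mu> * (\<Sum>a<Suc n. (cmod (F a))\<^sup>2)"
    by (rule le)
  also have "(\<Sum>a<Suc n. (cmod (F a))\<^sup>2) = (\<Sum>a<n. (cmod (v $ a))\<^sup>2)"
    using sum_insert_index[OF i, of "\<lambda>a. (cmod (F a))\<^sup>2"] by (simp add: F)
  finally have "l \<le> \<mu>"
    using ev(2) by simp
  with \<mu> show thesis
    by (rule that)
qed

text \<open>The polynomial splits over the complex numbers and its roots are eigenvalues, hence
  real. From here on the spectrum with multiplicity is represented by such a factorization, without
  diagonalizing.\<close>

lemma hermitian_char_poly: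
  assumes A: "A \<in> carrier_mat n n" and herm: "hermitian_mat A"
  obtains l :: "nat \<Rightarrow> real" where "char_poly A = (\<Prod>i<n. [:- complex_of_real (l i), 1:])"
proof -
  obtain as where as: "char_poly A = (\<Prod>a\<leftarrow>as. [:- a, 1:])" "length as = n"
    using char_poly_factorized[OF A] by auto
  have real: "of_real (Re a) = a" if "a \<in> set as" for a
  proof -
    have "poly (char_poly A) a = 0"
      using that by (auto simp: as(1) poly_prod_list prod_list_zero_iff)
    then show ?thesis
      using hermitian_eigenvalue_real[OF A herm] by (simp add: eigenvalue_root_char_poly[OF A])
  qed
  have "char_poly A = (\<Prod>i<n. [:- (as ! i), 1:])"
    by (simp add: as prod.list_conv_set_nth atLeast0LessThan)
  also have "\<dots> = (\<Prod>i<n. [:- complex_of_real (Re (as ! i)), 1:])"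
    using real as(2) by (intro prod.cong) auto
  finally show thesis
    by (rule that)
qed

lemma eigenvalue_iff_real_spectrum:
  assumes A: "A \<in> carrier_mat n n"
    and "char_poly A = (\<Prod>i<n. [:- complex_of_real (l i), 1:])"
  shows "eigenvalue A (complex_of_real x) \<longleftrightarrow> (\<exists>i<n. x = l i)"
  by (auto simp: eigenvalue_root_char_poly[OF A] assms(2) poly_prod simp flip: of_real_minus of_real_add of_real_diff)

section \<open>Derivatives and coefficients of products of linear factors; the trace\<close>

text \<open>With \<open>T\<close> the sum of the reciprocals and \<open>U\<close> the sum of their
  squares, \<open>p' = p * T\<close> and \<open>T' = - U\<close>, so
  \<open>p'' = p * (T^2 - U)\<close>. The induction adds one linear factor by the product
  rule.\<close>

lemma poly_pderiv_prod_linear: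
  fixes l :: "nat \<Rightarrow> 'a :: field" and n :: nat
  assumes "\<And>i. i < n \<Longrightarrow> y \<noteq> l i"
  defines "p \<equiv> (\<Prod>i<n. [:- l i, 1:])"
  shows "poly (pderiv p) y = poly p y * (\<Sum>i<n. 1 / (y - l i))"
    and "poly (pderiv (pderiv p)) y =
      poly p y * ((\<Sum>i<n. 1 / (y - l i))\<^sup>2 - (\<Sum>i<n. (1 / (y - l i))\<^sup>2))"
proof -
  have "poly (pderiv p) y = poly p y * (\<Sum>i<n. 1 / (y - l i)) \<and>
    poly (pderiv (pderiv p)) y =
      poly p y * ((\<Sum>i<n. 1 / (y - l i))\<^sup>2 - (\<Sum>i<n. (1 / (y - l i))\<^sup>2))"
    using assms(1) unfolding p_def
  proof (induction n)
    case 0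
    show ?case by simp
  next
    case (Suc n)
    define q where "q = (\<Prod>i<n. [:- l i, 1:])"
    define T where "T = (\<Sum>i<n. 1 / (y - l i))"
    define U where "U = (\<Sum>i<n. (1 / (y - l i))\<^sup>2)"
    have IH: "poly (pderiv q) y = poly q y * T" "poly (pderiv (pderiv q)) y = poly q y * (T\<^sup>2 - U)"
      using Suc unfolding q_def T_def U_def by auto
    define L where "L = [:- l n, 1:]"
    define d where "d = y - l n"
    have L: "pderiv L = 1" "poly L y = d"
      by (simp_all add: L_def d_def pderiv_pCons)
    have d: "d \<noteq> 0"
      using Suc.prems[of n] by (simp add: d_def)
    have "pderiv (q * L) = pderiv q * L + q"
      by (simp add: pderiv_mult L)
    moreover have "pderiv (pderiv q * L + q) = pderiv (pderiv q) * L + 2 * pderiv q"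
      by (simp add: pderiv_mult pderiv_add L)
    ultimately have "poly (pderiv (q * L)) y = poly q y * d * (T + 1 / d)"
      "poly (pderiv (pderiv (q * L))) y = poly q y * d * ((T + 1 / d)\<^sup>2 - (U + (1 / d)\<^sup>2))"
      using d by (simp_all add: IH L field_simps power2_eq_square)
    moreover have "(\<Prod>i<Suc n. [:- l i, 1:]) = q * L" "poly (q * L) y = poly q y * d"
      by (simp_all add: q_def L L_def[symmetric])
    moreover have "(\<Sum>i<Suc n. 1 / (y - l i)) = T + 1 / d"
      "(\<Sum>i<Suc n. (1 / (y - l i))\<^sup>2) = U + (1 / d)\<^sup>2"
      by (simp_all add: T_def U_def d_def)
    ultimately show ?case
      by (simp only: )
  qed
  then show "poly (pderiv p) y = poly p y * (\<Sum>i<n. 1 / (y - l i))"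
    and "poly (pderiv (pderiv p)) y =
      poly p y * ((\<Sum>i<n. 1 / (y - l i))\<^sup>2 - (\<Sum>i<n. (1 / (y - l i))\<^sup>2))"
    by auto
qed

lemma coeff_prod_linear:
  fixes l :: "nat \<Rightarrow> 'a :: idom"
  shows "coeff (\<Prod>i<Suc n. [:- l i, 1:]) n = - (\<Sum>i<Suc n. l i)"
proof (induction n)
  case 0
  show ?case by simp
next
  case (Suc n)
  define q where "q = (\<Prod>i<Suc n. [:- l i, 1:])"
  have "degree q = Suc n"
    unfolding q_def by (subst degree_prod_eq_sum_degree) auto
  moreover have "lead_coeff q = 1"
    unfolding q_def by (subst lead_coeff_prod) auto
  ultimately have "coeff q (Suc n) = 1"
    by simp
  moreover have "coeff q n = - (\<Sum>i<Suc n. l i)"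
    unfolding q_def by (rule Suc.IH)
  moreover have "(\<Prod>i<Suc (Suc n). [:- l i, 1:]) = [:- l (Suc n), 1:] * q"
    unfolding q_def by (subst prod.lessThan_Suc) (rule mult.commute)
  ultimately show ?case
    by (simp only: mult_pCons_left) simp
qed

text \<open>Induction through \<open>pderiv_char_poly\<close>: the derivative is the sum of the
  characteristic polynomials of the one-index deletions. Together with
  \<open>coeff_prod_linear\<close> this makes the trace the sum of the eigenvalues.\<close>

lemma coeff_char_poly_trace:
  fixes A :: "complex mat"
  assumes "A \<in> carrier_mat (Suc n) (Suc n)"
  shows "coeff (char_poly A) n = - (\<Sum>i<Suc n. A $$ (i, i))"
  using assms
proof (induction n arbitrary: A)
  case 0
  then show ?case
    by (simp add: char_poly_defs det_single)
next
  case (Suc n)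
  define t where "t = (\<Sum>i<Suc (Suc n). A $$ (i, i))"
  have "of_nat (Suc n) * coeff (char_poly A) (Suc n) = coeff (pderiv (char_poly A)) n"
    by (simp add: coeff_pderiv)
  also have "\<dots> = (\<Sum>i<Suc (Suc n). coeff (char_poly (mat_delete A i i)) n)"
    by (simp add: pderiv_char_poly[OF Suc.prems] coeff_sum)
  also have "\<dots> = (\<Sum>i<Suc (Suc n). - (t - A $$ (i, i)))"
  proof (rule sum.cong[OF refl])
    fix i
    assume "i \<in> {..<Suc (Suc n)}"
    then have i: "i < Suc (Suc n)" by simp
    show "coeff (char_poly (mat_delete A i i)) n = - (t - A $$ (i, i))"
      unfolding Suc.IH[OF mat_delete_diag_carrier[OF Suc.prems]] t_def
      by (simp add: mat_delete_diag_index[OF Suc.prems i] del: sum.lessThan_Suc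
          flip: sum_insert_index[OF i, of "\<lambda>a. A $$ (a, a)"])
  qed
  \<comment> \<open>Each diagonal entry is missing from exactly one of the \<open>n + 2\<close>
    deletions, so the trace \<open>t\<close> is counted \<open>n + 1\<close> times.\<close>
  also have "\<dots> = of_nat (Suc n) * (- t)"
    by (simp add: sum_negf sum_subtractf flip: t_def del: sum.lessThan_Suc) (simp add: algebra_simps)
  finally show ?case
    unfolding t_def by (simp only: mult_cancel_left of_nat_eq_0_iff) simp
qed

section \<open>The barrier argument\<close>

text \<open>For the spectrum \<open>l\<close> this is \<open>\<chi>'' \<le> \<phi> * \<chi>'\<close>
  at \<open>y\<close>, divided by \<open>\<chi>(y)\<close>. The resolvent identity expresses the
  sums at \<open>y\<close> through \<open>P\<close> and \<open>Q\<close>, mixed sums with weights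
  taken at \<open>b\<close>; Cauchy-Schwarz and the barrier at \<open>b\<close> then
  suffice.\<close>

lemma barrier_shift:
  fixes l :: "'a \<Rightarrow> real"
  assumes "\<phi> > 0" and y: "y = b - 1 / \<phi>" and lt: "\<And>i. i \<in> I \<Longrightarrow> l i < y"
    and W: "(\<Sum>i\<in>I. 1 / (b - l i)) \<le> \<phi>"
  shows "(\<Sum>i\<in>I. 1 / (y - l i))\<^sup>2 - (\<Sum>i\<in>I. (1 / (y - l i))\<^sup>2) \<le> \<phi> * (\<Sum>i\<in>I. 1 / (y - l i))"
proof -
  define d where "d = 1 / \<phi>"
  have d: "d > 0" "d * \<phi> = 1"
    using \<open>\<phi> > 0\<close> by (simp_all add: d_def)
  define r where "r i = 1 / (y - l i)" for i
  define w where "w i = 1 / (b - l i)" for i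
  have rw: "r i \<ge> 0" "w i \<ge> 0" "r i = w i + d * (w i * r i)" if "i \<in> I" for i
  proof -
    have pos: "y - l i > 0" "b - l i > 0" and b: "b - l i = (y - l i) + d"
      using lt[OF that] d(1) y unfolding d_def by linarith+
    \<comment> \<open>The scalar resolvent identity, for the points \<open>y\<close> and
      \<open>b = y + d\<close>.\<close>
    have "1 / c = 1 / (c + d) + d * (1 / (c + d) * (1 / c))" if "c > 0" for c
      using that d(1) by (simp add: divide_simps)
    from this[OF pos(1)] show "r i = w i + d * (w i * r i)"
      unfolding r_def w_def b .
    show "r i \<ge> 0" "w i \<ge> 0"
      unfolding r_def w_def using pos by simp_all
  qed
  define T where "T = sum r I"
  define P where "P = (\<Sum>i\<in>I. w i * r i)"
  define Q where "Q = (\<Sum>i\<in>I. w i * (r i)\<^sup>2)"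
  have T: "T = sum w I + d * P"
    unfolding T_def P_def sum_distrib_left sum.distrib[symmetric]
    by (intro sum.cong refl rw)
  have U: "(\<Sum>i\<in>I. (r i)\<^sup>2) = P + d * Q"
    unfolding P_def Q_def sum_distrib_left sum.distrib[symmetric]
  proof (intro sum.cong refl)
    fix i assume "i \<in> I"
    have "(r i)\<^sup>2 = (w i + d * (w i * r i)) * r i"
      unfolding power2_eq_square by (rule arg_cong[OF rw(3)[OF \<open>i \<in> I\<close>]])
    also have "\<dots> = w i * r i + d * (w i * (r i)\<^sup>2)"
      by (simp add: power2_eq_square algebra_simps)
    finally show "(r i)\<^sup>2 = w i * r i + d * (w i * (r i)\<^sup>2)" .
  qed
  have nonneg: "P \<ge> 0" "Q \<ge> 0" "T \<ge> 0"
    unfolding P_def Q_def T_def using rw by (auto intro!: sum_nonneg)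
  \<comment> \<open>Splitting \<open>w = sqrt w * sqrt w\<close> lets Cauchy-Schwarz bound
    \<open>P^2\<close> by the barrier at \<open>b\<close> times \<open>Q\<close>.\<close>
  have "P\<^sup>2 = (\<Sum>i\<in>I. sqrt (w i) * (sqrt (w i) * r i))\<^sup>2"
    unfolding P_def using rw by (auto simp: mult.assoc[symmetric] intro!: arg_cong[of _ _ "\<lambda>x. x\<^sup>2"] sum.cong)
  also have "\<dots> \<le> (\<Sum>i\<in>I. (sqrt (w i))\<^sup>2) * (\<Sum>i\<in>I. (sqrt (w i) * r i)\<^sup>2)"
    by (rule Cauchy_Schwarz_sum_squares)
  also have "\<dots> = sum w I * Q"
    unfolding Q_def using rw by (simp add: power_mult_distrib)
  finally have PQ: "P\<^sup>2 \<le> sum w I * Q" .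
  have W': "sum w I \<le> \<phi>"
    using W by (simp add: w_def)
  then have W1: "d * sum w I \<le> 1"
    using d by (metis mult_left_mono less_eq_real_def)
  \<comment> \<open>Since the barrier at \<open>b\<close> is at most \<open>\<phi>\<close>,
    \<open>T - \<phi> \<le> d * P\<close>. After expanding the other \<open>T\<close>, the factor
    \<open>d * sum w I \<le> 1\<close> can be pulled out, leaving \<open>P + d * Q\<close>, the sum
    of the squares of \<open>r\<close>.\<close>
  have "T\<^sup>2 - \<phi> * T = T * (T - \<phi>)"
    by (simp add: power2_eq_square algebra_simps)
  also have "\<dots> \<le> T * (d * P)"
    using nonneg W' T by (intro mult_left_mono) auto
  also have "\<dots> = (d * sum w I) * P + d * (d * P\<^sup>2)"
    by (simp add: T power2_eq_square algebra_simps)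
  also have "\<dots> \<le> (d * sum w I) * P + d * (d * (sum w I * Q))"
    using d PQ by (intro add_left_mono mult_left_mono) auto
  also have "\<dots> = (d * sum w I) * (P + d * Q)"
    by (simp add: algebra_simps)
  also have "\<dots> \<le> 1 * (P + d * Q)"
    using W1 nonneg d by (intro mult_right_mono) auto
  finally have "T\<^sup>2 - (\<Sum>i\<in>I. (r i)\<^sup>2) \<le> \<phi> * T"
    by (simp add: U)
  then show ?thesis
    by (simp add: T_def r_def)
qed

lemma poly_real_spectrum:
  fixes l :: "nat \<Rightarrow> real" and y :: real
  assumes "\<And>i. i < n \<Longrightarrow> l i < y"
  defines "p \<equiv> (\<Prod>i<n. [:- complex_of_real (l i), 1:])" and "P \<equiv> (\<Prod>i<n. y - l i)"
  shows "poly p y = of_real P"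
    and "poly (pderiv p) y = of_real (P * (\<Sum>i<n. 1 / (y - l i)))"
    and "poly (pderiv (pderiv p)) y =
      of_real (P * ((\<Sum>i<n. 1 / (y - l i))\<^sup>2 - (\<Sum>i<n. (1 / (y - l i))\<^sup>2)))"
proof -
  have ne: "complex_of_real y \<noteq> of_real (l i)" if "i < n" for i
    using assms(1)[OF that] by simp
  show *: "poly p y = of_real P"
    by (simp add: p_def P_def poly_prod)
  show "poly (pderiv p) y = of_real (P * (\<Sum>i<n. 1 / (y - l i)))"
    using poly_pderiv_prod_linear(1)[of n "complex_of_real y" "\<lambda>i. of_real (l i)", OF ne] *
    by (simp add: p_def)
  show "poly (pderiv (pderiv p)) y =
      of_real (P * ((\<Sum>i<n. 1 / (y - l i))\<^sup>2 - (\<Sum>i<n. (1 / (y - l i))\<^sup>2)))"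
    using poly_pderiv_prod_linear(2)[of n "complex_of_real y" "\<lambda>i. of_real (l i)", OF ne] *
    by (simp add: p_def)
qed

text \<open>The barriers \<open>t i\<close> of the one-index deletions at \<open>y\<close>, averaged
  with the positive weights \<open>p i = \<chi>\<^sub>i(y)\<close>, do not exceed
  \<open>\<phi>\<close>; hence some single \<open>t i\<close> does not either.\<close>

lemma barrier_step:
  assumes A: "A \<in> carrier_mat (Suc n) (Suc n)" and herm: "hermitian_mat A" and "n > 0"
    and spec: "char_poly A = (\<Prod>i<Suc n. [:- complex_of_real (l i), 1:])"
    and lt: "\<And>i. i < Suc n \<Longrightarrow> l i < b"
    and barrier: "(\<Sum>i<Suc n. 1 / (b - l i)) \<le> \<phi>" and "\<phi> > 0"
  obtains i l' where "i < Suc n"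
    and "char_poly (mat_delete A i i) = (\<Prod>j<n. [:- complex_of_real (l' j), 1:])"
    and "\<And>j. j < n \<Longrightarrow> l' j < b - 1 / \<phi>"
    and "(\<Sum>j<n. 1 / (b - 1 / \<phi> - l' j)) \<le> \<phi>"
proof -
  define y where "y = b - 1 / \<phi>"
  have lt_y: "l i < y" if i: "i < Suc n" for i
  proof -
    \<comment> \<open>Since \<open>n > 0\<close> there is a second index; its positive term makes
      \<open>1 / (b - l i) < \<phi>\<close> strict, so \<open>l i\<close> lies strictly below
      \<open>y\<close>.\<close>
    obtain j where j: "j < Suc n" "j \<noteq> i"
      using \<open>n > 0\<close> by (cases "i = 0") auto
    have "1 / (b - l i) < 1 / (b - l i) + 1 / (b - l j)"
      using lt[OF j(1)] by simp
    also have "\<dots> = (\<Sum>i\<in>{i, j}. 1 / (b - l i))"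
      using j(2) by simp
    also have "\<dots> \<le> (\<Sum>i<Suc n. 1 / (b - l i))"
      using i j lt by (intro sum_mono2) (auto simp: less_imp_le)
    finally have "1 / (b - l i) < \<phi>"
      using barrier by linarith
    then show ?thesis
      using lt[OF i] \<open>\<phi> > 0\<close> by (simp add: y_def field_simps)
  qed
  have "\<exists>l' :: nat \<Rightarrow> real. char_poly (mat_delete A i i) = (\<Prod>j<n. [:- complex_of_real (l' j), 1:]) \<and>
      (\<forall>j<n. l' j < y)" if i: "i < Suc n" for i
  proof -
    note Di = mat_delete_diag_carrier[OF A, of i]
    obtain l' where l': "char_poly (mat_delete A i i) = (\<Prod>j<n. [:- complex_of_real (l' j), 1:])"
      using hermitian_char_poly[OF Di hermitian_mat_delete[OF A herm i]] by blast
    have "l' j < y" if "j < n" for j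
    proof -
      \<comment> \<open>Interlacing keeps the spectra of all deletions below \<open>y\<close>, which
        makes the weights \<open>p i\<close> positive.\<close>
      have "eigenvalue (mat_delete A i i) (l' j)"
        using that by (auto simp: eigenvalue_iff_real_spectrum[OF Di l'])
      then obtain \<mu> :: real where "eigenvalue A \<mu>" "l' j \<le> \<mu>"
        by (rule hermitian_Cauchy_interlacing_max[OF A herm i])
      then show ?thesis
        using lt_y le_less_trans by (auto simp: eigenvalue_iff_real_spectrum[OF A spec])
    qed
    then show ?thesis
      using l' by blast
  qed
  then obtain L :: "nat \<Rightarrow> nat \<Rightarrow> real" where
    L: "\<And>i. i < Suc n \<Longrightarrow> char_poly (mat_delete A i i) = (\<Prod>j<n. [:- complex_of_real (L i j), 1:])"
    and L_lt: "\<And>i j. i < Suc n \<Longrightarrow> j < n \<Longrightarrow> L i j < y"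
    by metis
  define P where "P = (\<Prod>i<Suc n. y - l i)"
  define T where "T = (\<Sum>i<Suc n. 1 / (y - l i))"
  define U where "U = (\<Sum>i<Suc n. (1 / (y - l i))\<^sup>2)"
  define p where "p i = (\<Prod>j<n. y - L i j)" for i
  define t where "t i = (\<Sum>j<n. 1 / (y - L i j))" for i
  have "P > 0"
    unfolding P_def using lt_y by (intro prod_pos) auto
  have p_pos: "p i > 0" if "i < Suc n" for i
    unfolding p_def using L_lt[OF that] by (intro prod_pos) auto
  have "complex_of_real (\<Sum>i<Suc n. p i) = poly (pderiv (char_poly A)) y"
    using L_lt L by (simp add: pderiv_char_poly[OF A] poly_sum poly_real_spectrum(1) p_def
        del: sum.lessThan_Suc)
  also have "\<dots> = complex_of_real (P * T)"
    unfolding spec P_def T_def by (rule poly_real_spectrum(2)) (rule lt_y)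
  finally have sum_p: "(\<Sum>i<Suc n. p i) = P * T"
    by (simp only: of_real_eq_iff)
  have "complex_of_real (\<Sum>i<Suc n. p i * t i) = poly (pderiv (pderiv (char_poly A))) y"
    using L_lt L by (simp add: pderiv_char_poly[OF A] pderiv_sum poly_sum poly_real_spectrum(2) p_def t_def
        del: sum.lessThan_Suc)
  also have "\<dots> = complex_of_real (P * (T\<^sup>2 - U))"
    unfolding spec P_def T_def U_def by (rule poly_real_spectrum(3)) (rule lt_y)
  finally have "(\<Sum>i<Suc n. p i * t i) = P * (T\<^sup>2 - U)"
    by (simp only: of_real_eq_iff)
  also have "\<dots> \<le> P * (\<phi> * T)"
    unfolding T_def U_def
    using \<open>P > 0\<close> barrier_shift[OF \<open>\<phi> > 0\<close> y_def, of "{..<Suc n}" l] lt_y barrier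
    by (intro mult_left_mono) auto
  also have "\<dots> = (\<Sum>i<Suc n. p i * \<phi>)"
    using sum_p by (simp flip: sum_distrib_right)
  \<comment> \<open>Otherwise all terms would compare strictly the other way, and so would the
    sums.\<close>
  finally have "\<exists>i<Suc n. p i * t i \<le> p i * \<phi>"
    using sum_strict_mono[of "{..<Suc n}" "\<lambda>i. p i * \<phi>" "\<lambda>i. p i * t i"] by (force simp: not_le)
  then obtain i where i: "i < Suc n" "p i * t i \<le> p i * \<phi>"
    by blast
  then have "t i \<le> \<phi>"
    using p_pos by simp
  then show thesis
    using that[OF i(1) L[OF i(1)]] L_lt[OF i(1)] by (simp add: t_def y_def)
qed

text \<open>Induction on the size \<open>m\<close> down to \<open>n\<close>: each
  \<open>barrier_step\<close> lowers \<open>b\<close> by \<open>1 / \<phi>\<close> with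
  \<open>\<phi>\<close> fixed. The map \<open>e\<close> lists the surviving indices; composing it
  with \<open>insert_index i\<close> restores the numbering before a deletion.\<close>

lemma principal_submatrix_form_bound:
  fixes A :: "complex mat"
  assumes "n \<le> m" "n > 0" "\<phi> > 0" "A \<in> carrier_mat m m" "hermitian_mat A"
    and "char_poly A = (\<Prod>i<m. [:- complex_of_real (l i), 1:])"
    and "\<And>i. i < m \<Longrightarrow> l i < b" "(\<Sum>i<m. 1 / (b - l i)) \<le> \<phi>"
  shows "\<exists>e. inj_on e {..<n} \<and> e ` {..<n} \<subseteq> {..<m} \<and>
    (\<forall>f. Re (\<Sum>i<n. \<Sum>j<n. cnj (f i) * A $$ (e i, e j) * f j) \<le>
      (b - (real m - real n) / \<phi>) * (\<Sum>i<n. (cmod (f i))\<^sup>2))"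
  using assms
proof (induction m arbitrary: A l b rule: dec_induct)
  case base
  \<comment> \<open>With no index left to delete, the top eigenvalue is below the current
    \<open>b\<close>.\<close>
  obtain \<mu> :: real where \<mu>: "eigenvalue A \<mu>"
    and le: "\<And>f. Re (sesq_form A f f) \<le> \<mu> * (\<Sum>i<n. (cmod (f i))\<^sup>2)"
    using hermitian_Rayleigh base by blast
  have "\<mu> < b"
    using \<mu> base by (auto simp: eigenvalue_iff_real_spectrum)
  then have "\<mu> * (\<Sum>i<n. (cmod (f i))\<^sup>2) \<le> b * (\<Sum>i<n. (cmod (f i))\<^sup>2)" for f :: "nat \<Rightarrow> complex"
    by (intro mult_right_mono) (auto simp: sum_nonneg)
  then have "Re (sesq_form A f f) \<le> b * (\<Sum>i<n. (cmod (f i))\<^sup>2)" for f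
    using le order_trans by blast
  then show ?case
    using base by (intro exI[of _ id]) (auto simp: sesq_form_def)
next
  case (step m)
  note A = \<open>A \<in> carrier_mat (Suc m) (Suc m)\<close>
  have "m > 0"
    using step by simp
  obtain i l' where i: "i < Suc m"
    and l': "char_poly (mat_delete A i i) = (\<Prod>j<m. [:- complex_of_real (l' j), 1:])"
      "\<And>j. j < m \<Longrightarrow> l' j < b - 1 / \<phi>" "(\<Sum>j<m. 1 / (b - 1 / \<phi> - l' j)) \<le> \<phi>"
    using barrier_step[OF A _ \<open>m > 0\<close>, of l b \<phi>] step.prems by blast
  obtain e where e: "inj_on e {..<n}" "e ` {..<n} \<subseteq> {..<m}"
    and le: "\<And>f. Re (\<Sum>a<n. \<Sum>b<n. cnj (f a) * mat_delete A i i $$ (e a, e b) * f b) \<le>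
      (b - 1 / \<phi> - (real m - real n) / \<phi>) * (\<Sum>a<n. (cmod (f a))\<^sup>2)"
    using step.IH[OF \<open>n > 0\<close> \<open>\<phi> > 0\<close> mat_delete_diag_carrier[OF A]
        hermitian_mat_delete[OF A \<open>hermitian_mat A\<close> i] l'] by blast
  have "mat_delete A i i $$ (e a, e b) = A $$ (insert_index i (e a), insert_index i (e b))"
    if "a < n" "b < n" for a b
    using that e(2) by (intro mat_delete_diag_index[OF A i]) auto
  then have "(\<Sum>a<n. \<Sum>b<n. cnj (f a) * mat_delete A i i $$ (e a, e b) * f b) =
    (\<Sum>a<n. \<Sum>b<n. cnj (f a) * A $$ ((insert_index i \<circ> e) a, (insert_index i \<circ> e) b) * f b)" for f
    by (intro sum.cong refl) simp
  moreover have "inj_on (insert_index i \<circ> e) {..<n}"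
    using e(1) insert_index_inj_on by (intro comp_inj_on)
  moreover have "(insert_index i \<circ> e) ` {..<n} \<subseteq> {..<Suc m}"
    using e(2) by (auto simp: insert_index_def)
  moreover have "b - 1 / \<phi> - (real m - real n) / \<phi> = b - (real (Suc m) - real n) / \<phi>"
    by (simp add: diff_divide_distrib add_divide_distrib)
  ultimately show ?case
    using le by (intro exI[of _ "insert_index i \<circ> e"]) (simp only: simp_thms)
qed

section \<open>Gram matrices of Bessel families\<close>

lemma gram_form:
  fixes W :: "nat \<Rightarrow> nat \<Rightarrow> complex"
  shows "(\<Sum>a<n. \<Sum>b<n. cnj (f a) * (\<Sum>l<k. cnj (W a l) * W b l) * f b) =
    of_real (\<Sum>l<k. (cmod (\<Sum>a<n. W a l * f a))\<^sup>2)"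
proof -
  have "complex_of_real (\<Sum>l<k. (cmod (\<Sum>a<n. W a l * f a))\<^sup>2) =
    (\<Sum>l<k. cnj (\<Sum>a<n. W a l * f a) * (\<Sum>b<n. W b l * f b))"
    by (simp add: complex_norm_square mult.commute del: of_real_power)
  also have "\<dots> = (\<Sum>l<k. \<Sum>a<n. \<Sum>b<n. cnj (f a) * (cnj (W a l) * W b l) * f b)"
    by (simp only: cnj_sum sum_product) (simp add: mult_ac)
  also have "\<dots> = (\<Sum>a<n. \<Sum>l<k. \<Sum>b<n. cnj (f a) * (cnj (W a l) * W b l) * f b)"
    by (rule sum.swap)
  also have "\<dots> = (\<Sum>a<n. \<Sum>b<n. \<Sum>l<k. cnj (f a) * (cnj (W a l) * W b l) * f b)"
    by (intro sum.cong refl sum.swap)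
  finally show ?thesis
    by (simp add: sum_distrib_left sum_distrib_right)
qed

text \<open>The Gram matrix has its spectrum in [0, 1] by the Bessel inequality and trace
  \<open>m * s^2\<close> by the norms. The barrier argument thus runs from \<open>1 + s\<close> with
  \<open>\<phi> = m\<close>.\<close>

lemma Bessel_family_subset:
  fixes V :: "nat \<Rightarrow> nat \<Rightarrow> complex" and s :: real
  assumes "s > 0" and norms: "\<And>a. a < m \<Longrightarrow> (\<Sum>l<k. (cmod (V a l))\<^sup>2) = s\<^sup>2"
    and Bessel: "\<And>x. (\<Sum>a<m. (cmod (\<Sum>l<k. cnj (V a l) * x l))\<^sup>2) \<le> (\<Sum>l<k. (cmod (x l))\<^sup>2)"
    and "0 < n" "n \<le> m"
  obtains e where "inj_on e {..<n}" "e ` {..<n} \<subseteq> {..<m}"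
    and "\<And>x. (\<Sum>a<n. (cmod (\<Sum>l<k. cnj (V (e a) l) * x l))\<^sup>2) \<le>
      (real n / real m + s) * (\<Sum>l<k. (cmod (x l))\<^sup>2)"
proof -
  define A where "A = mat m m (\<lambda>(a, b). \<Sum>l<k. cnj (V a l) * V b l)"
  have A: "A \<in> carrier_mat m m"
    by (simp add: A_def)
  have herm: "hermitian_mat A"
    by (rule hermitian_matI[OF A]) (simp add: A_def mult.commute)
  have form: "sesq_form A f f = of_real (\<Sum>l<k. (cmod (\<Sum>a<m. V a l * f a))\<^sup>2)" for f
    unfolding gram_form[symmetric] by (simp add: sesq_form_def A_def)
  obtain l where spec: "char_poly A = (\<Prod>i<m. [:- complex_of_real (l i), 1:])"
    using hermitian_char_poly[OF A herm] by blast
  have l01: "0 \<le> l i" "l i \<le> 1" if "i < m" for i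
  proof -
    have "eigenvalue A (l i)"
      using that by (auto simp: eigenvalue_iff_real_spectrum[OF A spec])
    then obtain v where v: "eigenvector A v (l i)"
      by (auto simp: eigenvalue_def)
    define q where "q = (\<Sum>a<m. (cmod (v $ a))\<^sup>2)"
    define z where "z = (\<Sum>l<k. (cmod (\<Sum>a<m. V a l * v $ a))\<^sup>2)"
    have "q > 0" "complex_of_real (l i * q) = complex_of_real z"
      using eigenvectorD_sesq_form[OF A v] by (simp_all add: form q_def z_def)
    then have "l i * q = z"
      by (simp only: of_real_eq_iff)
    moreover have "z \<ge> 0"
      by (simp add: z_def sum_nonneg)
    \<comment> \<open>The Bessel inequality bounds the map taking \<open>x\<close> to its inner
      products; its adjoint is the linear combination map in \<open>z\<close>.\<close>
    moreover have "z \<le> q"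
      using adjoint_norm_bound[where p = m and q = k and M = "\<lambda>a l. cnj (V a l)" and c = 1 and y = "\<lambda>a. v $ a"] Bessel
      by (simp add: z_def q_def)
    ultimately show "0 \<le> l i" "l i \<le> 1"
      using \<open>q > 0\<close> by (auto simp: zero_le_mult_iff)
  qed
  have trace: "(\<Sum>i<m. l i) = real m * s\<^sup>2"
  proof -
    \<comment> \<open>The trace is read off from the coefficient of index
      \<open>m - 1\<close>.\<close>
    obtain m' where m: "m = Suc m'"
      using assms by (cases m) auto
    have "A $$ (a, a) = complex_of_real (s\<^sup>2)" if "a < m" for a
    proof -
      have "A $$ (a, a) = complex_of_real (\<Sum>l<k. (cmod (V a l))\<^sup>2)"
        using that by (simp add: A_def complex_norm_square mult.commute del: of_real_power)
      then show ?thesis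
        by (simp only: norms[OF that])
    qed
    then have "(\<Sum>a<m. A $$ (a, a)) = complex_of_real (real m * s\<^sup>2)"
      by simp
    moreover have "(\<Sum>a<m. A $$ (a, a)) = complex_of_real (\<Sum>i<m. l i)"
      using coeff_char_poly_trace[OF A[unfolded m]] coeff_prod_linear[of "\<lambda>i. complex_of_real (l i)" m']
      unfolding spec[unfolded m] m by (simp only: neg_equal_iff_equal of_real_sum)
    ultimately show ?thesis
      by (simp only: of_real_eq_iff)
  qed
  \<comment> \<open>The function \<open>1 / (1 + s - x)\<close> is convex on [0, 1], so it lies
    below its chord from \<open>1 / (1 + s)\<close> to \<open>1 / s\<close>; the chord sums to a
    function of the trace.\<close>
  have "(\<Sum>i<m. 1 / (1 + s - l i)) \<le> (\<Sum>i<m. (1 - l i) / (1 + s) + l i / s)"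
  proof (rule sum_mono)
    fix i
    assume "i \<in> {..<m}"
    then have "0 \<le> l i" "l i \<le> 1"
      using l01 by auto
    have "(1 - l i) / (1 + s) + l i / s - 1 / (1 + s - l i) = l i * (1 - l i) / (s * (1 + s) * (1 + s - l i))"
      using \<open>s > 0\<close> \<open>l i \<le> 1\<close> by (simp add: divide_simps) (simp add: algebra_simps power2_eq_square)
    also have "\<dots> \<ge> 0"
      using \<open>s > 0\<close> \<open>0 \<le> l i\<close> \<open>l i \<le> 1\<close> by simp
    finally show "1 / (1 + s - l i) \<le> (1 - l i) / (1 + s) + l i / s"
      by simp
  qed
  also have "\<dots> = (real m - real m * s\<^sup>2) / (1 + s) + real m * s\<^sup>2 / s"
    by (simp add: sum.distrib sum_subtractf trace flip: sum_divide_distrib)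
  \<comment> \<open>The sum is \<open>m * (1 - s) + m * s\<close>, so starting at
    \<open>1 + s\<close> gives exactly the barrier value \<open>m\<close>.\<close>
  also have "\<dots> = real m"
    using \<open>s > 0\<close> by (simp add: field_simps power2_eq_square)
  finally have barrier: "(\<Sum>i<m. 1 / (1 + s - l i)) \<le> real m" .
  have lt: "l i < 1 + s" if "i < m" for i
    using l01(2)[OF that] \<open>s > 0\<close> by simp
  have "real m > 0"
    using assms by simp
  obtain e where e: "inj_on e {..<n}" "e ` {..<n} \<subseteq> {..<m}"
    and le: "\<And>f. Re (\<Sum>i<n. \<Sum>j<n. cnj (f i) * A $$ (e i, e j) * f j) \<le>
      (1 + s - (real m - real n) / real m) * (\<Sum>i<n. (cmod (f i))\<^sup>2)"
    using principal_submatrix_form_bound[OF \<open>n \<le> m\<close> \<open>0 < n\<close> \<open>real m > 0\<close> A herm spec lt barrier] by blast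
  have c: "1 + s - (real m - real n) / real m = real n / real m + s"
    using \<open>real m > 0\<close> by (simp add: field_simps)
  have "(\<Sum>l<k. (cmod (\<Sum>a<n. V (e a) l * f a))\<^sup>2) \<le> (real n / real m + s) * (\<Sum>i<n. (cmod (f i))\<^sup>2)" for f
  proof -
    have "(\<Sum>i<n. \<Sum>j<n. cnj (f i) * A $$ (e i, e j) * f j) =
      of_real (\<Sum>l<k. (cmod (\<Sum>a<n. V (e a) l * f a))\<^sup>2)"
      unfolding gram_form[symmetric] using e(2) by (intro sum.cong refl) (auto simp: A_def image_subset_iff)
    then show ?thesis
      using le[of f] by (simp only: c Re_complex_of_real)
  qed
  \<comment> \<open>The bound so far concerns linear combinations of the chosen vectors; the adjoint
    turns it into one on inner products with \<open>x\<close>.\<close>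
  from adjoint_norm_bound[where p = k and q = n and M = "\<lambda>l a. V (e a) l", OF this] \<open>s > 0\<close>
  show thesis
    by (intro that[OF e]) simp
qed

section \<open>From unit vectors and indices 1 to m to the Bessel form\<close>

theorem theorem3p3:
  shows "\<exists>C::real. C > 0 \<and>
    (\<forall>(k::nat) (N::nat) (m::nat) (v :: nat \<Rightarrow> complex vec).
      N > 0 \<longrightarrow>
      (\<forall>i\<in>{1..m}. v i \<in> carrier_vec k \<and> euclidean_norm (v i) = 1 / sqrt (real N)) \<longrightarrow>
      (\<forall>u\<in>carrier_vec k. euclidean_norm u = 1 \<longrightarrow>
        (\<Sum>i\<in>{1..m}. (cmod (u \<bullet>c v i))\<^sup>2) = 1) \<longrightarrow>
      (\<forall>n::nat. n < m \<longrightarrow>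
        (\<exists>S. S \<subseteq> {1..m} \<and> card S = n \<and>
          (\<forall>u\<in>carrier_vec k. euclidean_norm u = 1 \<longrightarrow>
            (\<Sum>i\<in>S. (cmod (u \<bullet>c v i))\<^sup>2) \<le> real n / real m + C / sqrt (real N)))))"
proof (intro exI[of _ "1 :: real"] conjI allI impI)
  fix k N m n :: nat and v :: "nat \<Rightarrow> complex vec"
  assume "N > 0" and v: "\<forall>i\<in>{1..m}. v i \<in> carrier_vec k \<and> euclidean_norm (v i) = 1 / sqrt (real N)"
    and frame: "\<forall>u\<in>carrier_vec k. euclidean_norm u = 1 \<longrightarrow> (\<Sum>i\<in>{1..m}. (cmod (u \<bullet>c v i))\<^sup>2) = 1"
    and "n < m"
  \<comment> \<open>The vectors are renumbered from 0, matching matrix indices.\<close>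
  define V where "V a l = v (Suc a) $ l" for a l
  define s where "s = 1 / sqrt (real N)"
  have "s > 0"
    using \<open>N > 0\<close> by (simp add: s_def)
  have norm_sq: "(euclidean_norm u)\<^sup>2 = (\<Sum>l<k. (cmod (u $ l))\<^sup>2)" if "u \<in> carrier_vec k" for u
    using that by (simp add: euclidean_norm_def L2_set_def sum_nonneg)
  have inner: "u \<bullet>c v (Suc a) = (\<Sum>l<k. cnj (V a l) * u $ l)" if "u \<in> carrier_vec k" "a < m" for u a
  proof -
    have "dim_vec (v (Suc a)) = k"
      using that v by auto
    then show ?thesis
      by (simp add: scalar_prod_def V_def atLeast0LessThan mult.commute)
  qed
  have norms: "(\<Sum>l<k. (cmod (V a l))\<^sup>2) = s\<^sup>2" if "a < m" for a
    using that v norm_sq[of "v (Suc a)"] by (simp add: V_def s_def)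
  \<comment> \<open>The frame identity is given on unit vectors; scaling by \<open>sqrt q\<close>
    extends it to every nonzero \<open>x\<close>.\<close>
  have Bessel: "(\<Sum>a<m. (cmod (\<Sum>l<k. cnj (V a l) * x l))\<^sup>2) \<le> (\<Sum>l<k. (cmod (x l))\<^sup>2)" for x
  proof (cases "(\<Sum>l<k. (cmod (x l))\<^sup>2) = 0")
    case True
    then have "\<forall>l<k. x l = 0"
      by (subst (asm) sum_nonneg_eq_0_iff) auto
    then show ?thesis
      by simp
  next
    case False
    define q where "q = (\<Sum>l<k. (cmod (x l))\<^sup>2)"
    have q: "q > 0"
      using False unfolding q_def by (simp add: less_le sum_nonneg)
    define u where "u = vec k (\<lambda>l. x l / sqrt q)"
    have u: "u \<in> carrier_vec k"
      by (simp add: u_def)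
    have "(euclidean_norm u)\<^sup>2 = (\<Sum>l<k. (cmod (x l))\<^sup>2 / q)"
      unfolding norm_sq[OF u] using q by (intro sum.cong) (auto simp: u_def norm_divide power_divide)
    also have "\<dots> = 1"
      using q by (simp add: q_def flip: sum_divide_distrib)
    finally have "euclidean_norm u = 1"
      by (simp add: power2_eq_1_iff euclidean_norm_def) (metis L2_set_nonneg neg_0_le_iff_le not_one_le_zero)
    then have "1 = (\<Sum>i\<in>{1..m}. (cmod (u \<bullet>c v i))\<^sup>2)"
      using frame u by simp
    also have "\<dots> = (\<Sum>a<m. (cmod (u \<bullet>c v (Suc a)))\<^sup>2)"
      by (simp add: sum.atLeast1_atMost_eq)
    also have "\<dots> = (\<Sum>a<m. (cmod (\<Sum>l<k. cnj (V a l) * x l))\<^sup>2 / q)"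
    proof (intro sum.cong refl)
      fix a
      assume "a \<in> {..<m}"
      then have "u \<bullet>c v (Suc a) = (\<Sum>l<k. cnj (V a l) * u $ l)"
        by (intro inner[OF u]) simp
      also have "\<dots> = (\<Sum>l<k. cnj (V a l) * x l) / sqrt q"
        by (simp add: u_def sum_divide_distrib)
      finally have "u \<bullet>c v (Suc a) = (\<Sum>l<k. cnj (V a l) * x l) / sqrt q" .
      then show "(cmod (u \<bullet>c v (Suc a)))\<^sup>2 = (cmod (\<Sum>l<k. cnj (V a l) * x l))\<^sup>2 / q"
        using q by (simp add: norm_divide power_divide)
    qed
    finally show ?thesis
      using q by (simp add: q_def field_simps flip: sum_divide_distrib)
  qed
  show "\<exists>S. S \<subseteq> {1..m} \<and> card S = n \<and>
    (\<forall>u\<in>carrier_vec k. euclidean_norm u = 1 \<longrightarrow>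
      (\<Sum>i\<in>S. (cmod (u \<bullet>c v i))\<^sup>2) \<le> real n / real m + 1 / sqrt (real N))"
  \<comment> \<open>The selection lemma assumes \<open>0 < n\<close>; for \<open>n = 0\<close> the
    empty set works.\<close>
  proof (cases "n = 0")
    case True
    then show ?thesis
      by (intro exI[of _ "{}"]) auto
  next
    case False
    then obtain e where e: "inj_on e {..<n}" "e ` {..<n} \<subseteq> {..<m}"
      and le: "\<And>x. (\<Sum>a<n. (cmod (\<Sum>l<k. cnj (V (e a) l) * x l))\<^sup>2) \<le>
        (real n / real m + s) * (\<Sum>l<k. (cmod (x l))\<^sup>2)"
      using Bessel_family_subset[OF \<open>s > 0\<close> norms Bessel, of n] \<open>n < m\<close> by auto
    have inj: "inj_on (\<lambda>a. Suc (e a)) {..<n}"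
      using e(1) by (auto simp: inj_on_def)
    show ?thesis
    proof (intro exI[of _ "(\<lambda>a. Suc (e a)) ` {..<n}"] conjI ballI impI)
      show "(\<lambda>a. Suc (e a)) ` {..<n} \<subseteq> {1..m}"
        using e(2) by (auto simp: Suc_le_eq)
      show "card ((\<lambda>a. Suc (e a)) ` {..<n}) = n"
        by (simp add: card_image[OF inj])
      fix u :: "complex vec"
      assume u: "u \<in> carrier_vec k" "euclidean_norm u = 1"
      have "(\<Sum>i\<in>(\<lambda>a. Suc (e a)) ` {..<n}. (cmod (u \<bullet>c v i))\<^sup>2) =
        (\<Sum>a<n. (cmod (\<Sum>l<k. cnj (V (e a) l) * u $ l))\<^sup>2)"
        unfolding sum.reindex[OF inj] o_def
        using e(2) by (intro sum.cong refl arg_cong[of _ _ "\<lambda>z. (cmod z)\<^sup>2"] inner u) auto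
      also have "\<dots> \<le> real n / real m + s"
        using le[of "\<lambda>l. u $ l"] norm_sq[OF u(1)] u(2) by simp
      finally show "(\<Sum>i\<in>(\<lambda>a. Suc (e a)) ` {..<n}. (cmod (u \<bullet>c v i))\<^sup>2) \<le>
        real n / real m + 1 / sqrt (real N)"
        by (simp add: s_def)
    qed
  qed
qed simp

end
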